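(* Let $P,Q\in AdS$ be arbitrary given points. Then there is a smooth curve in $AdS$, horizontal with respect to the distribution $\mathcal D=\operatorname{span}\{X,Y\}$, connecting $P$ with $Q$.
   Context: $\mathbb R^{2,2}$ is $\mathbb R^4$ with $\langle x,y\rangle=-x_1y_1-x_2y_2+x_3y_3+x_4y_4$, and $AdS=\{x\in\mathbb R^4:\langle x,x\rangle=-1\}$, a smooth 3-dimensional submanifold. The vector fields $T(x)=(-x_2,x_1,x_4,-x_3)$, $X(x)=(x_3,x_4,x_1,x_2)$, $Y(x)=(x_4,-x_3,-x_2,x_1)$ form an orthogonal basis of each tangent space of $AdS$ with $\langle T,T\rangle=-1$, $\langle X,X\rangle=\langle Y,Y\rangle=1$. A curve $c:[0,1]\to AdS$ is horizontal with respect to $\mathcal D=\operatorname{span}\{X,Y\}$ if $\dot c(s)\in\operatorname{span}\{X(c(s)),Y(c(s))\}$ for (almost) every $s$. *)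

theory Defs
  imports "HOL-Analysis.Analysis"
begin

lemma vector_4 [simp]:
  "(vector [a,b,c,d] :: ('a::zero)^4) $ 1 = a"
  "(vector [a,b,c,d] :: ('a::zero)^4) $ 2 = b"
  "(vector [a,b,c,d] :: ('a::zero)^4) $ 3 = c"
  "(vector [a,b,c,d] :: ('a::zero)^4) $ 4 = d"
  unfolding vector_def by simp_all

definition inner22 :: "real^4 \<Rightarrow> real^4 \<Rightarrow> real" where
  "inner22 x y = - x$1 * y$1 - x$2 * y$2 + x$3 * y$3 + x$4 * y$4"

definition AdS :: "(real^4) set" where
  "AdS = {x. inner22 x x = -1}"

definition X_field :: "real^4 \<Rightarrow> real^4" where
  "X_field x = vector [x$3, x$4, x$1, x$2]"

definition Y_field :: "real^4 \<Rightarrow> real^4" where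
  "Y_field x = vector [x$4, - x$3, - x$2, x$1]"

definition hor_dist :: "real^4 \<Rightarrow> (real^4) set" where
  "hor_dist x = span {X_field x, Y_field x}"

lemma frame_tangent:
  "inner22 x (X_field x) = 0" "inner22 x (Y_field x) = 0"
  by (simp_all add: inner22_def X_field_def Y_field_def)

lemma frame_orthonormal:
  assumes "x \<in> AdS"
  shows "inner22 (X_field x) (X_field x) = 1" "inner22 (Y_field x) (Y_field x) = 1"
    "inner22 (X_field x) (Y_field x) = 0"
  using assms by (simp_all add: AdS_def inner22_def X_field_def Y_field_def)

(* C^infinity: derivatives of every order exist on all of I. Derivatives are taken within I,
   hence one-sided at the endpoints of a compact interval. Intended for nondegenerate intervals,
   where the derivative within I is unique. Since AdS is an embedded submanifold of R^4,
   a curve with values in AdS is smooth as a map into AdS iff it is smooth as a map into R^4. *)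
definition smooth_curve_on :: "real set \<Rightarrow> (real \<Rightarrow> 'a::real_normed_vector) \<Rightarrow> bool" where
  "smooth_curve_on I c \<longleftrightarrow>
     (\<forall>n. ((\<lambda>f t. vector_derivative f (at t within I)) ^^ n) c differentiable_on I)"

(* Required at every parameter value; for a continuously differentiable curve in AdS this is
   the same as requiring it almost everywhere. *)
definition horizontal_on :: "real set \<Rightarrow> (real \<Rightarrow> real^4) \<Rightarrow> bool" where
  "horizontal_on I c \<longleftrightarrow>
     (\<forall>s\<in>I. \<exists>v\<in>hor_dist (c s). (c has_vector_derivative v) (at s within I))"

end

theory Submission
  imports Defs
begin

text \<open>
  Write \<open>z = x\<^sub>1 + i x\<^sub>2\<close> and \<open>w = x\<^sub>3 + i x\<^sub>4\<close>, so that AdS is \<open>|z|\<^sup>2 - |w|\<^sup>2 = 1\<close>. In the coordinates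
  \<open>z = cosh \<sigma> exp (i \<alpha>)\<close>, \<open>w = sinh \<sigma> exp (i \<beta>)\<close> a curve is horizontal if
  \<open>\<alpha>' = - h \<beta>'\<close> with \<open>h = tanh\<^sup>2 \<sigma>\<close>. Fix a quadratic \<open>\<sigma>\<close> with the prescribed end values for which
  \<open>h\<close> is not constant and look for \<open>\<beta>' = a + b h\<close> with constant \<open>a\<close>, \<open>b\<close>. The end values of \<open>\<alpha>\<close> and \<open>\<beta>\<close>
  give two linear equations for \<open>a\<close> and \<open>b\<close>, whose determinant is the variance of \<open>h\<close> on \<open>[0, 1]\<close>
  and hence positive.
\<close>

subsection \<open>Smoothness from closure under differentiation\<close>

text \<open>By induction every iterated derivative agrees on the interval with a member of
  \<open>K\<close>, so it is differentiable again. As \<open>a < b\<close>, the derivative within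
  the interval is unique, and \<open>vector_derivative\<close> returns the member supplied by
  \<open>closed\<close>.\<close>

lemma smooth_curve_on_if_closed:
  fixes K :: "(real \<Rightarrow> 'a::real_normed_vector) set"
  assumes "a < b" and "c \<in> K"
    and closed: "\<And>f. f \<in> K \<Longrightarrow>
      \<exists>g\<in>K. \<forall>t\<in>{a..b}. (f has_vector_derivative g t) (at t within {a..b})"
  shows "smooth_curve_on {a..b} c"
proof -
  let ?D = "\<lambda>f t. vector_derivative f (at t within {a..b})"
  \<comment> \<open>The iterates are controlled only on the interval, so closure is first passed on
    to every \<open>F\<close> that agrees there with a member of \<open>K\<close>.\<close>
  have step: "\<exists>g\<in>K. \<forall>t\<in>{a..b}. (F has_vector_derivative g t) (at t within {a..b})"
    if "f \<in> K" "\<forall>t\<in>{a..b}. F t = f t" for f F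
    using closed[OF that(1)] that(2) by (metis has_vector_derivative_transform)
  have iterate: "\<exists>g\<in>K. \<forall>t\<in>{a..b}. (?D ^^ n) c t = g t" for n
  proof (induction n)
    case 0
    then show ?case using \<open>c \<in> K\<close> by auto
  next
    case (Suc n)
    then obtain g where g: "g \<in> K"
        "\<And>t. t \<in> {a..b} \<Longrightarrow> ((?D ^^ n) c has_vector_derivative g t) (at t within cbox a b)"
      using step by fastforce
    from vector_derivative_within_cbox[OF \<open>a < b\<close> _ g(2)]
    have "(?D ^^ Suc n) c t = g t" if "t \<in> {a..b}" for t
      using that by simp
    with g(1) show ?case by blast
  qed
  show ?thesis
    unfolding smooth_curve_on_def differentiable_on_def
    using step iterate by (meson differentiableI_vector)
qed

text \<open>The unital real algebra generated by \<open>G\<close>; the inductive form gives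
  induction over sums and products.\<close>

inductive_set fun_algebra :: "('a \<Rightarrow> real) set \<Rightarrow> ('a \<Rightarrow> real) set" for G where
  const: "(\<lambda>_. k) \<in> fun_algebra G"
| gen: "g \<in> G \<Longrightarrow> g \<in> fun_algebra G"
| add: "f \<in> fun_algebra G \<Longrightarrow> g \<in> fun_algebra G \<Longrightarrow> (\<lambda>x. f x + g x) \<in> fun_algebra G"
| mult: "f \<in> fun_algebra G \<Longrightarrow> g \<in> fun_algebra G \<Longrightarrow> (\<lambda>x. f x * g x) \<in> fun_algebra G"

text \<open>By the sum and product rules, closure under differentiation has to be checked on the
  generators alone.\<close>

lemma fun_algebra_closed:
  fixes G :: "(real \<Rightarrow> real) set"
  assumes gens: "\<And>g. g \<in> G \<Longrightarrow>
      \<exists>g'\<in>fun_algebra G. \<forall>t\<in>I. (g has_real_derivative g' t) (at t within I)"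
    and "f \<in> fun_algebra G"
  shows "\<exists>f'\<in>fun_algebra G. \<forall>t\<in>I. (f has_real_derivative f' t) (at t within I)"
  using assms(2)
proof induction
  case (const k)
  show ?case by (rule bexI[OF _ fun_algebra.const[of 0]]) auto
next
  case (gen g)
  then show ?case by (rule gens)
next
  case (add f g)
  then obtain f' g' where "f' \<in> fun_algebra G" "g' \<in> fun_algebra G"
    "\<forall>t\<in>I. (f has_real_derivative f' t) (at t within I)"
    "\<forall>t\<in>I. (g has_real_derivative g' t) (at t within I)" by blast
  then show ?case
    by (intro bexI[of _ "\<lambda>x. f' x + g' x"]) (auto intro: fun_algebra.add DERIV_add)
next
  case (mult f g)
  then obtain f' g' where "f' \<in> fun_algebra G" "g' \<in> fun_algebra G"
    "\<forall>t\<in>I. (f has_real_derivative f' t) (at t within I)"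
    "\<forall>t\<in>I. (g has_real_derivative g' t) (at t within I)" by blast
  with mult.hyps show ?case
    by (intro bexI[of _ "\<lambda>x. f' x * g x + g' x * f x"])
      (auto intro: fun_algebra.add fun_algebra.mult DERIV_mult)
qed

lemma has_vector_derivative_vecI:
  fixes c :: "real \<Rightarrow> real^'n"
  assumes "\<And>i. ((\<lambda>s. c s $ i) has_real_derivative c' $ i) (at t within I)"
  shows "(c has_vector_derivative c') (at t within I)"
  unfolding has_vector_derivative_def
proof (subst has_derivative_componentwise_within, rule ballI)
  fix b :: "real^'n" assume "b \<in> Basis"
  then obtain i where b: "b = axis i 1" by (auto simp: Basis_vec_def)
  show "((\<lambda>x. c x \<bullet> b) has_derivative (\<lambda>x. (x *\<^sub>R c') \<bullet> b)) (at t within I)"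
    using assms[of i] by (simp add: b inner_axis has_field_derivative_def mult_commute_abs)
qed

lemma smooth_curve_on_vecI:
  fixes c :: "real \<Rightarrow> real^'n"
  assumes "a < b" and comps: "\<And>i. (\<lambda>t. c t $ i) \<in> fun_algebra G"
    and gens: "\<And>g. g \<in> G \<Longrightarrow>
      \<exists>g'\<in>fun_algebra G. \<forall>t\<in>{a..b}. (g has_real_derivative g' t) (at t within {a..b})"
  shows "smooth_curve_on {a..b} c"
proof (rule smooth_curve_on_if_closed[OF \<open>a < b\<close>])
  let ?K = "{f :: real \<Rightarrow> real^'n. \<forall>i. (\<lambda>t. f t $ i) \<in> fun_algebra G}"
  show "c \<in> ?K" using comps by simp
  fix f assume "f \<in> ?K"
  then have "\<forall>i. \<exists>g\<in>fun_algebra G. \<forall>t\<in>{a..b}. ((\<lambda>t. f t $ i) has_real_derivative g t) (at t within {a..b})"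
    using fun_algebra_closed[OF gens] by blast
  then obtain g where g: "\<And>i. g i \<in> fun_algebra G"
    "\<And>i t. t \<in> {a..b} \<Longrightarrow> ((\<lambda>t. f t $ i) has_real_derivative g i t) (at t within {a..b})"
    by metis
  show "\<exists>g\<in>?K. \<forall>t\<in>{a..b}. (f has_vector_derivative g t) (at t within {a..b})"
    by (rule bexI[of _ "\<lambda>t. \<chi> i. g i t"]) (auto simp: g intro!: has_vector_derivative_vecI)
qed

subsection \<open>Polar coordinates\<close>

definition ads_polar :: "real \<Rightarrow> real \<Rightarrow> real \<Rightarrow> real^4" where
  "ads_polar s a b = vector [cosh s * cos a, cosh s * sin a, sinh s * cos b, sinh s * sin b]"

lemma ads_polar_in_AdS: "ads_polar s a b \<in> AdS"
proof -
  have "inner22 (ads_polar s a b) (ads_polar s a b) =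
      - (cosh s)\<^sup>2 * ((cos a)\<^sup>2 + (sin a)\<^sup>2) + (sinh s)\<^sup>2 * ((cos b)\<^sup>2 + (sin b)\<^sup>2)"
    unfolding inner22_def ads_polar_def vector_4 by algebra
  then show ?thesis
    using hyperbolic_pythagoras[of s] by (simp add: AdS_def)
qed

text \<open>The origin is included: there the radius is 0 and any angle serves.\<close>

lemma polar_coordinates:
  obtains a where "x = sqrt (x\<^sup>2 + y\<^sup>2) * cos a" "y = sqrt (x\<^sup>2 + y\<^sup>2) * sin a"
proof
  have "Complex x y = rcis (cmod (Complex x y)) (Arg (Complex x y))"
    by (simp add: rcis_cmod_Arg)
  then show "x = sqrt (x\<^sup>2 + y\<^sup>2) * cos (Arg (Complex x y))"
    "y = sqrt (x\<^sup>2 + y\<^sup>2) * sin (Arg (Complex x y))"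
    by (simp_all add: complex_eq_iff cmod_def)
qed

text \<open>With \<open>sinh s\<close> equal to the modulus of \<open>w\<close>, the equation of AdS
  makes \<open>cosh s\<close> the modulus of \<open>z\<close>. The choice \<open>s \<ge> 0\<close>
  later allows \<open>s\<close> to be recovered from \<open>(tanh s)\<^sup>2\<close>.\<close>

lemma AdS_polar:
  assumes "P \<in> AdS"
  obtains s a b where "s \<ge> 0" "P = ads_polar s a b"
proof -
  define s where "s = arsinh (sqrt ((P$3)\<^sup>2 + (P$4)\<^sup>2))"
  obtain b where b: "P$3 = sqrt ((P$3)\<^sup>2 + (P$4)\<^sup>2) * cos b" "P$4 = sqrt ((P$3)\<^sup>2 + (P$4)\<^sup>2) * sin b"
    by (rule polar_coordinates)
  obtain a where a: "P$1 = sqrt ((P$1)\<^sup>2 + (P$2)\<^sup>2) * cos a" "P$2 = sqrt ((P$1)\<^sup>2 + (P$2)\<^sup>2) * sin a"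
    by (rule polar_coordinates)
  have "(P$1)\<^sup>2 + (P$2)\<^sup>2 = (P$3)\<^sup>2 + (P$4)\<^sup>2 + 1"
    using assms by (simp add: AdS_def inner22_def power2_eq_square)
  then have "cosh s = sqrt ((P$1)\<^sup>2 + (P$2)\<^sup>2)" "sinh s = sqrt ((P$3)\<^sup>2 + (P$4)\<^sup>2)"
    unfolding s_def by (simp_all add: cosh_arsinh_real)
  then have "P = ads_polar s a b"
    using a b by (simp add: vec_eq_iff forall_4 ads_polar_def)
  moreover have "s \<ge> 0"
    unfolding s_def by (metis real_sqrt_ge_0_iff sinh_arsinh_real sinh_real_nonneg_iff sum_power2_ge_zero)
  ultimately show ?thesis using that by blast
qed

text \<open>The product of the velocity with the field T is \<open>- ((cosh \<sigma>)\<^sup>2 *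
  \<alpha>' + (sinh \<sigma>)\<^sup>2 * \<beta>')\<close>. It vanishes exactly under the condition
  on \<open>\<alpha>\<close>, while \<open>\<sigma>\<close> stays free.\<close>

lemma horizontal_ads_polar:
  fixes \<sigma> \<alpha> \<beta> :: "real \<Rightarrow> real"
  assumes \<sigma>: "\<And>t. t \<in> I \<Longrightarrow> (\<sigma> has_real_derivative \<sigma>' t) (at t within I)"
    and \<beta>: "\<And>t. t \<in> I \<Longrightarrow> (\<beta> has_real_derivative \<beta>' t) (at t within I)"
    and \<alpha>: "\<And>t. t \<in> I \<Longrightarrow> (\<alpha> has_real_derivative - (tanh (\<sigma> t))\<^sup>2 * \<beta>' t) (at t within I)"
  shows "horizontal_on I (\<lambda>t. ads_polar (\<sigma> t) (\<alpha> t) (\<beta> t))"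
  unfolding horizontal_on_def
proof (rule ballI)
  fix t assume t: "t \<in> I"
  let ?c = "ads_polar (\<sigma> t) (\<alpha> t) (\<beta> t)"
  let ?T = "tanh (\<sigma> t)" and ?C = "cosh (\<sigma> t)" and ?S = "sinh (\<sigma> t)"
  let ?ca = "cos (\<alpha> t)" and ?sa = "sin (\<alpha> t)" and ?cb = "cos (\<beta> t)" and ?sb = "sin (\<beta> t)"
  let ?p = "\<sigma>' t" and ?q = "\<beta>' t"
  let ?cd = "?cb * ?ca + ?sb * ?sa" and ?sd = "?sb * ?ca - ?cb * ?sa"
  \<comment> \<open>\<open>u + i v = exp (i (\<beta> - \<alpha>)) (\<sigma>' + i \<beta>' tanh \<sigma>)\<close>: the velocity \<open>u X + v Y\<close> means
    \<open>z' = (u - i v) w\<close> and \<open>w' = (u + i v) z\<close>.\<close>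
  define u where "u = ?cd * ?p - ?sd * ?q * ?T"
  define v where "v = ?sd * ?p + ?cd * ?q * ?T"
  \<comment> \<open>Eliminating \<open>sinh\<close> turns the four coordinate identities into
    polynomial ones modulo \<open>pa\<close> and \<open>pb\<close>.\<close>
  have S: "?S = ?T * ?C"
    by (simp add: tanh_def)
  have pa: "?sa * ?sa = 1 - ?ca * ?ca" and pb: "?sb * ?sb = 1 - ?cb * ?cb"
    using sin_cos_squared_add[of "\<alpha> t"] sin_cos_squared_add[of "\<beta> t"]
    by (simp_all add: power2_eq_square algebra_simps)
  let ?d1 = "?S * ?p * ?ca + ?C * (?sa * (?T\<^sup>2 * ?q))"
  let ?d2 = "?S * ?p * ?sa - ?C * (?ca * (?T\<^sup>2 * ?q))"
  let ?d3 = "?C * ?p * ?cb - ?S * (?sb * ?q)"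
  let ?d4 = "?C * ?p * ?sb + ?S * (?cb * ?q)"
  let ?d = "vector [?d1, ?d2, ?d3, ?d4] :: real^4"
  have "((\<lambda>t. ads_polar (\<sigma> t) (\<alpha> t) (\<beta> t)) has_vector_derivative ?d) (at t within I)"
  proof (rule has_vector_derivative_vecI)
    fix i :: 4
    have "\<forall>i. ((\<lambda>s. ads_polar (\<sigma> s) (\<alpha> s) (\<beta> s) $ i) has_real_derivative ?d $ i) (at t within I)"
      unfolding forall_4 ads_polar_def vector_4
      by (safe; (rule derivative_eq_intros \<sigma>[OF t] \<alpha>[OF t] \<beta>[OF t] refl)+; simp add: algebra_simps)
    then show "((\<lambda>s. ads_polar (\<sigma> s) (\<alpha> s) (\<beta> s) $ i) has_real_derivative ?d $ i) (at t within I)"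
      by blast
  qed
  moreover have "?d = u *\<^sub>R X_field ?c + v *\<^sub>R Y_field ?c"
    unfolding vec_eq_iff forall_4
    unfolding vector_4 X_field_def Y_field_def ads_polar_def vector_add_component vector_scaleR_component
      real_scaleR_def u_def v_def S
    using pa pb by (intro conjI; algebra)
  moreover have "u *\<^sub>R X_field ?c + v *\<^sub>R Y_field ?c \<in> hor_dist ?c"
    unfolding hor_dist_def by (intro span_add span_scale span_base) auto
  ultimately show "\<exists>v\<in>hor_dist ?c. ((\<lambda>t. ads_polar (\<sigma> t) (\<alpha> t) (\<beta> t)) has_vector_derivative v) (at t within I)"
    by metis
qed

text \<open>The angles enter only through their sines and cosines, and their derivatives are
  polynomials in \<open>tanh \<sigma>\<close>. Since \<open>\<sigma>'\<close> is affine in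
  \<open>t\<close> and the derivative of \<open>tanh \<sigma>\<close> is
  \<open>(1 - (tanh \<sigma>)\<^sup>2) * \<sigma>'\<close>, finitely many generators give an algebra
  closed under differentiation.\<close>

lemma smooth_ads_polar:
  fixes \<sigma> \<alpha> \<beta> :: "real \<Rightarrow> real"
  assumes "l < r"
    and \<sigma>: "\<And>t. t \<in> {l..r} \<Longrightarrow> (\<sigma> has_real_derivative p * t + q) (at t within {l..r})"
    and \<beta>: "\<And>t. t \<in> {l..r} \<Longrightarrow> (\<beta> has_real_derivative a + b * (tanh (\<sigma> t))\<^sup>2) (at t within {l..r})"
    and \<alpha>: "\<And>t. t \<in> {l..r} \<Longrightarrow>
      (\<alpha> has_real_derivative - (tanh (\<sigma> t))\<^sup>2 * (a + b * (tanh (\<sigma> t))\<^sup>2)) (at t within {l..r})"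
  shows "smooth_curve_on {l..r} (\<lambda>t. ads_polar (\<sigma> t) (\<alpha> t) (\<beta> t))"
proof -
  let ?T = "\<lambda>t. tanh (\<sigma> t)"
  let ?G = "{\<lambda>t. t, \<lambda>t. cosh (\<sigma> t), \<lambda>t. sinh (\<sigma> t), ?T, \<lambda>t. cos (\<alpha> t), \<lambda>t. sin (\<alpha> t),
    \<lambda>t. cos (\<beta> t), \<lambda>t. sin (\<beta> t)}"
  let ?A = "fun_algebra ?G"
  have A: "(\<lambda>t. t) \<in> ?A" "(\<lambda>t. cosh (\<sigma> t)) \<in> ?A" "(\<lambda>t. sinh (\<sigma> t)) \<in> ?A" "?T \<in> ?A"
    "(\<lambda>t. cos (\<alpha> t)) \<in> ?A" "(\<lambda>t. sin (\<alpha> t)) \<in> ?A" "(\<lambda>t. cos (\<beta> t)) \<in> ?A" "(\<lambda>t. sin (\<beta> t)) \<in> ?A"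
    by (rule fun_algebra.gen; simp)+
  note alg = A fun_algebra.const fun_algebra.add fun_algebra.mult
  \<comment> \<open>The derivatives are spelled with constants, sums and products only, the closure
    rules of \<open>fun_algebra\<close>; hence the factor \<open>-1\<close> in place of a minus
    sign.\<close>
  define s' where "s' = (\<lambda>t. p * t + q)"
  define b' where "b' = (\<lambda>t. a + b * (?T t * ?T t))"
  define a' where "a' = (\<lambda>t. -1 * (?T t * ?T t) * b' t)"
  have A': "s' \<in> ?A" "b' \<in> ?A" "a' \<in> ?A"
    unfolding s'_def b'_def a'_def by (intro alg)+
  have d: "(\<sigma> has_real_derivative s' t) (at t within {l..r})"
    "(\<beta> has_real_derivative b' t) (at t within {l..r})"
    "(\<alpha> has_real_derivative a' t) (at t within {l..r})" if "t \<in> {l..r}" for t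
    using \<sigma>[OF that] \<beta>[OF that] \<alpha>[OF that]
    by (simp_all add: s'_def b'_def a'_def power2_eq_square)
  show ?thesis
  proof (rule smooth_curve_on_vecI[OF \<open>l < r\<close>, where G = ?G])
    have "\<forall>i. (\<lambda>t. ads_polar (\<sigma> t) (\<alpha> t) (\<beta> t) $ i) \<in> ?A"
      unfolding forall_4 ads_polar_def vector_4 by (intro conjI alg)
    then show "(\<lambda>t. ads_polar (\<sigma> t) (\<alpha> t) (\<beta> t) $ i) \<in> ?A" for i by blast
  next
    fix g assume "g \<in> ?G"
    moreover have "\<exists>g'\<in>?A. \<forall>t\<in>{l..r}. ((\<lambda>t. t) has_real_derivative g' t) (at t within {l..r})"
      by (rule bexI[of _ "\<lambda>t. 1"]) (auto intro: alg)
    moreover have "\<exists>g'\<in>?A. \<forall>t\<in>{l..r}. ((\<lambda>t. cosh (\<sigma> t)) has_real_derivative g' t) (at t within {l..r})"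
      by (rule bexI[of _ "\<lambda>t. sinh (\<sigma> t) * s' t"])
        (auto intro!: alg A' derivative_eq_intros d)
    moreover have "\<exists>g'\<in>?A. \<forall>t\<in>{l..r}. ((\<lambda>t. sinh (\<sigma> t)) has_real_derivative g' t) (at t within {l..r})"
      by (rule bexI[of _ "\<lambda>t. cosh (\<sigma> t) * s' t"])
        (auto intro!: alg A' derivative_eq_intros d)
    moreover have "\<exists>g'\<in>?A. \<forall>t\<in>{l..r}. (?T has_real_derivative g' t) (at t within {l..r})"
      by (rule bexI[of _ "\<lambda>t. (1 + -1 * (?T t * ?T t)) * s' t"])
        ((auto intro!: derivative_eq_intros d simp: power2_eq_square)[1], intro alg A')
    moreover have "\<exists>g'\<in>?A. \<forall>t\<in>{l..r}. ((\<lambda>t. cos (\<alpha> t)) has_real_derivative g' t) (at t within {l..r})"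
      by (rule bexI[of _ "\<lambda>t. -1 * sin (\<alpha> t) * a' t"])
        ((auto intro!: derivative_eq_intros d)[1], intro alg A')
    moreover have "\<exists>g'\<in>?A. \<forall>t\<in>{l..r}. ((\<lambda>t. sin (\<alpha> t)) has_real_derivative g' t) (at t within {l..r})"
      by (rule bexI[of _ "\<lambda>t. cos (\<alpha> t) * a' t"])
        (auto intro!: alg A' derivative_eq_intros d)
    moreover have "\<exists>g'\<in>?A. \<forall>t\<in>{l..r}. ((\<lambda>t. cos (\<beta> t)) has_real_derivative g' t) (at t within {l..r})"
      by (rule bexI[of _ "\<lambda>t. -1 * sin (\<beta> t) * b' t"])
        ((auto intro!: derivative_eq_intros d)[1], intro alg A')
    moreover have "\<exists>g'\<in>?A. \<forall>t\<in>{l..r}. ((\<lambda>t. sin (\<beta> t)) has_real_derivative g' t) (at t within {l..r})"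
      by (rule bexI[of _ "\<lambda>t. cos (\<beta> t) * b' t"])
        (auto intro!: alg A' derivative_eq_intros d)
    ultimately show "\<exists>g'\<in>?A. \<forall>t\<in>{l..r}. (g has_real_derivative g' t) (at t within {l..r})"
      by (elim insertE emptyE) simp_all
  qed
qed

subsection \<open>Solving for the end values\<close>

lemma continuous_antiderivative_0:
  fixes f :: "real \<Rightarrow> real"
  assumes "continuous_on {0..1} f"
  obtains F where "F 0 = 0" "F 1 = integral {0..1} f"
    "\<And>t. t \<in> {0..1} \<Longrightarrow> (F has_real_derivative f t) (at t within {0..1})"
proof
  let ?F = "\<lambda>t. integral {0..t} f"
  show "?F 0 = 0" "?F 1 = integral {0..1} f" by auto
  show "(?F has_real_derivative f t) (at t within {0..1})" if "t \<in> {0..1}" for t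
    using integral_has_vector_derivative[OF assms that]
    by (simp add: has_real_derivative_iff_has_vector_derivative)
qed

text \<open>The difference of the two sides is the integral of \<open>(f t - m)\<^sup>2\<close> with
  \<open>m\<close> the mean of \<open>f\<close>. If this vanished, continuity would force
  \<open>f\<close> to be constantly \<open>m\<close>.\<close>

lemma variance_pos:
  fixes f :: "real \<Rightarrow> real"
  assumes cont: "continuous_on {0..1} f" and "x \<in> {0..1}" "y \<in> {0..1}" "f x \<noteq> f y"
  shows "integral {0..1} (\<lambda>t. (f t)\<^sup>2) > (integral {0..1} f)\<^sup>2"
proof -
  define m where "m = integral {0..1} f"
  let ?v = "\<lambda>t. (f t - m)\<^sup>2"
  have v: "continuous_on {0..1} ?v" by (intro continuous_intros cont)
  have "integral {0..1} ?v \<noteq> 0"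
    using integral_eq_0_iff[OF v] assms(2-4) by auto
  moreover have "integral {0..1} ?v \<ge> 0"
    by (rule integral_nonneg[OF integrable_continuous_interval[OF v]]) simp
  moreover have "(?v has_integral integral {0..1} (\<lambda>t. (f t)\<^sup>2) - 2 * m * m + m\<^sup>2) {0..1}"
  proof -
    have "((\<lambda>t. (f t)\<^sup>2 - 2 * m * f t + m\<^sup>2) has_integral
        integral {0..1} (\<lambda>t. (f t)\<^sup>2) - 2 * m * m + m\<^sup>2) {0..1}"
    proof (intro has_integral_add has_integral_diff)
      show "((\<lambda>t. (f t)\<^sup>2) has_integral integral {0..1} (\<lambda>t. (f t)\<^sup>2)) {0..1}"
        by (intro integrable_integral integrable_continuous_interval continuous_intros cont)
      show "((\<lambda>t. 2 * m * f t) has_integral 2 * m * m) {0..1}"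
        using has_integral_mult_right[OF integrable_integral[OF integrable_continuous_interval[OF cont]], of "2 * m"]
        by (simp add: m_def)
      show "((\<lambda>t::real. m\<^sup>2) has_integral m\<^sup>2) {0..1}"
        using has_integral_const_real[of "m\<^sup>2" 0 1] by simp
    qed
    then show ?thesis by (simp add: power2_diff algebra_simps)
  qed
  ultimately show ?thesis
    by (simp add: integral_unique m_def power2_eq_square)
qed

theorem theorem7:
  fixes P Q :: "real^4"
  assumes "P \<in> AdS" and "Q \<in> AdS"
  shows "\<exists>c :: real \<Rightarrow> real^4.
           smooth_curve_on {0..1} c \<and> c \<in> {0..1} \<rightarrow> AdS \<and> horizontal_on {0..1} c \<and>
           c 0 = P \<and> c 1 = Q"
proof -
  obtain s0 a0 b0 where P: "s0 \<ge> 0" "P = ads_polar s0 a0 b0"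
    using AdS_polar[OF assms(1)] .
  obtain s1 a1 b1 where Q: "s1 \<ge> 0" "Q = ads_polar s1 a1 b1"
    using AdS_polar[OF assms(2)] .
  \<comment> \<open>Linear interpolation plus a bump that is 0 at both ends and 1 at
    \<open>1/2\<close>. It keeps \<open>\<sigma>\<close> affine after one differentiation and puts
    \<open>\<sigma> (1/2)\<close> at \<open>(s0 + s1) / 2 + 1\<close>.\<close>
  define \<sigma> where "\<sigma> = (\<lambda>t::real. s0 + (s1 - s0) * t + 4 * t * (1 - t))"
  define h where "h = (\<lambda>t. (tanh (\<sigma> t))\<^sup>2)"
  have \<sigma>: "(\<sigma> has_real_derivative (- 8) * t + (s1 - s0 + 4)) (at t within {0..1})" for t
    unfolding \<sigma>_def by (auto intro!: derivative_eq_intros simp: algebra_simps)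
  have h: "continuous_on {0..1} h"
    unfolding h_def \<sigma>_def by (intro continuous_intros) (simp add: less_imp_neq[symmetric])
  have inj: "s = s'" if "(tanh s)\<^sup>2 = (tanh s')\<^sup>2" "s \<ge> 0" "s' \<ge> 0" for s s' :: real
    using that by (simp add: power2_eq_iff_nonneg)
  \<comment> \<open>Otherwise \<open>\<sigma> (1/2)\<close> would equal both \<open>s0\<close> and
    \<open>s1\<close>, and hence their mean, which it exceeds by 1.\<close>
  have "h (1/2) \<noteq> h 0 \<or> h (1/2) \<noteq> h 1"
  proof (rule ccontr)
    assume "\<not> ?thesis"
    then have "\<sigma> (1/2) = \<sigma> 0" "\<sigma> (1/2) = \<sigma> 1"
      using P(1) Q(1) by (auto simp: h_def \<sigma>_def intro!: inj)
    then show False by (simp add: \<sigma>_def field_simps)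
  qed
  then obtain x where x: "x \<in> {0..1}" "h (1/2) \<noteq> h x"
    by (metis atLeastAtMost_iff order_refl zero_le_one)
  define m where "m = integral {0..1} h"
  define n where "n = integral {0..1} (\<lambda>t. (h t)\<^sup>2)"
  have "n > m\<^sup>2"
    unfolding m_def n_def using variance_pos[OF h _ x] by simp
  \<comment> \<open>Solution of the linear system \<open>eqs\<close>, which prescribes the
    increments of \<open>\<beta>\<close> and \<open>- \<alpha>\<close> over the interval;
    \<open>n - m\<^sup>2\<close> is its determinant.\<close>
  define b where "b = (a0 - a1 - (b1 - b0) * m) / (n - m\<^sup>2)"
  define a where "a = b1 - b0 - b * m"
  have "b * (n - m\<^sup>2) = a0 - a1 - (b1 - b0) * m"
    using \<open>n > m\<^sup>2\<close> by (simp add: b_def)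
  then have eqs: "a + b * m = b1 - b0" "a * m + b * n = a0 - a1"
    by (simp_all add: a_def algebra_simps power2_eq_square)
  obtain H where H: "H 0 = 0" "H 1 = m"
    "\<And>t. t \<in> {0..1} \<Longrightarrow> (H has_real_derivative h t) (at t within {0..1})"
    using continuous_antiderivative_0[OF h] unfolding m_def by metis
  have h2: "continuous_on {0..1} (\<lambda>t. (h t)\<^sup>2)" by (intro continuous_intros h)
  obtain K where K: "K 0 = 0" "K 1 = n"
    "\<And>t. t \<in> {0..1} \<Longrightarrow> (K has_real_derivative (h t)\<^sup>2) (at t within {0..1})"
    using continuous_antiderivative_0[OF h2] unfolding n_def by metis
  \<comment> \<open>Antiderivatives of \<open>a + b * h\<close> and \<open>- h * (a + b * h)\<close>
    starting at \<open>b0\<close> and \<open>a0\<close>; by \<open>eqs\<close> they end at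
    \<open>b1\<close> and \<open>a1\<close>.\<close>
  define \<beta> where "\<beta> = (\<lambda>t. b0 + a * t + b * H t)"
  define \<alpha> where "\<alpha> = (\<lambda>t. a0 - (a * H t + b * K t))"
  have \<beta>: "(\<beta> has_real_derivative a + b * (tanh (\<sigma> t))\<^sup>2) (at t within {0..1})"
    if "t \<in> {0..1}" for t
    unfolding \<beta>_def h_def[symmetric]
    by (auto intro!: derivative_eq_intros H(3)[OF that] simp: h_def)
  have \<alpha>: "(\<alpha> has_real_derivative - (tanh (\<sigma> t))\<^sup>2 * (a + b * (tanh (\<sigma> t))\<^sup>2)) (at t within {0..1})"
    if "t \<in> {0..1}" for t
    unfolding \<alpha>_def
    by (auto intro!: derivative_eq_intros H(3)[OF that] K(3)[OF that]
        simp: h_def algebra_simps power2_eq_square)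
  let ?c = "\<lambda>t. ads_polar (\<sigma> t) (\<alpha> t) (\<beta> t)"
  have "smooth_curve_on {0..1} ?c"
    using smooth_ads_polar[OF zero_less_one \<sigma> \<beta> \<alpha>] .
  moreover have "horizontal_on {0..1} ?c"
    using horizontal_ads_polar[OF \<sigma> \<beta> \<alpha>] .
  moreover have "?c 0 = P"
    by (simp add: P \<sigma>_def \<alpha>_def \<beta>_def H K)
  moreover have "?c 1 = Q"
    using eqs by (simp add: Q \<sigma>_def \<alpha>_def \<beta>_def H K add.assoc)
  ultimately show ?thesis
    using ads_polar_in_AdS by (intro exI[of _ ?c]) auto
qed

end
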